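(* For every $j\in\{0,\dots,M\}$ let $N_j\in\mathbb{N}$, and let $\theta_{j,n}\in\mathbb{R}$, $w_{j,n}\in\mathbb{R}_+$, $n\in\{1,\dots,N_j\}$, be constants with $\sum_{n=1}^{N_j}w_{j,n}=1$, and let $\bar X(t)$ be the associated local volatility process defined in the context. Then the characteristic function of $\bar X(t)$ is given for every $u\in\mathbb{R}$ and $t\ge0$ by $$\varphi(u;\bar X(t))=e^{iux_0}\prod_{j=0}^M\sum_{n_j=1}^{N_j}w_{j,n_j}\,\varphi\bigl(u;Y_j^{\theta_{j,n_j}}(s_j(t))\bigr).$$
   Context: Fix $M\in\mathbb{N}$, $x_0\in\mathbb{R}$, $\lambda\ge0$ and a cdf $F_\eta$. For $j\in\{0,\dots,M\}$ let $W_j$ be a standard Brownian motion, $P_j$ a Poisson process with intensity $\lambda$, and $\eta_j(1),\eta_j(2),\dots$ i.i.d. real random variables with cdf $F_\eta$; all these are mutually independent. Let $b_j(t,z),\sigma_j(t,z)$ be real-valued functions, finite for all $t\ge0$ and bounded for all $z\in\mathbb{R}$. For $\theta\in\mathbb{R}$ the conditional component process is $$Y_j^{\theta}(t)=\int_0^t b_j(u,\theta)\,\mathrm{d}u+\int_0^t\sigma_j(u,\theta)\,\mathrm{d}W_j(u)+\sum_{i=1}^{P_j(t)}\eta_j(i).$$ Let $0=\tau_0<\tau_1<\dots<\tau_M<\infty$ be deterministic, $\tau_{M+1}=\infty$, and let $s_j(t)=0$ for $t<\tau_j$, $s_j(t)=t-\tau_j$ for $\tau_j\le t<\tau_{j+1}$,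 $s_j(t)=\tau_{j+1}-\tau_j$ for $t\ge\tau_{j+1}$. For $\bm\theta=(\theta_0,\dots,\theta_M)\in\mathbb{R}^{M+1}$ the conditional composite process is $X^{\bm\theta}(t)=x_0+\sum_{j=0}^M Y_j^{\theta_j}(s_j(t))$, and $$\beta(t;\bm\theta)=\sum_{j=0}^M b_j(s_j(t),\theta_j)\mathbf 1_{t\in[\tau_j,\tau_{j+1})},\qquad \gamma(t;\bm\theta)=\sum_{j=0}^M \sigma_j(s_j(t),\theta_j)\mathbf 1_{t\in[\tau_j,\tau_{j+1})}.$$ $f(x;Z)$ is the probability density function of $Z$ at $x$ and $\varphi(u;Z)=\mathbb{E}[e^{iuZ}]$. Local volatility process: for $\bm n=(n_0,\dots,n_M)$, $1\le n_j\le N_j$, put $\bm\theta_{\bm n}=(\theta_{0,n_0},\dots,\theta_{M,n_M})$ and $w_{\bm n}=\prod_{j=0}^M w_{j,n_j}$. The process $\bar X(t)$ is the unique strong solution of $$\mathrm{d}\bar X(t)=\bar\mu(t,\bar X(t))\,\mathrm{d}t+\bar\sigma(t,\bar X(t))\,\mathrm{d}\bar W(t)+\mathrm{d}\sum_{i=1}^{\bar N(t)}\bar\eta(i),\qquad \bar X(0)=x_0,$$ with $\bar W$ a standard Brownian motion, $\bar N$ a Poisson process with intensity $\lambda$, jump sizes $\bar\eta(i)$ with cdf $F_\eta$, and $$\bar\mu(t,x)=\frac{\sum_{\bm n}w_{\bm n}\beta(t;\bm\theta_{\bm n})f(x;X^{\bm\theta_{\bm n}}(t))}{\sum_{\bm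 n}w_{\bm n}f(x;X^{\bm\theta_{\bm n}}(t))},\qquad \bar\sigma^2(t,x)=\frac{\sum_{\bm n}w_{\bm n}\gamma^2(t;\bm\theta_{\bm n})f(x;X^{\bm\theta_{\bm n}}(t))}{\sum_{\bm n}w_{\bm n}f(x;X^{\bm\theta_{\bm n}}(t))}.$$ It has probability density function $f(x;\bar X(t))=\sum_{\bm n}w_{\bm n}f(x;X^{\bm\theta_{\bm n}}(t))$. *)

theory Defs
  imports "HOL-Probability.Probability"
begin

section \<open>Driving noise\<close>

definition brownian_motion :: "'a measure \<Rightarrow> (real \<Rightarrow> 'a \<Rightarrow> real) \<Rightarrow> bool" where
  "brownian_motion S W \<longleftrightarrow>
     (\<forall>t\<ge>0. W t \<in> borel_measurable S) \<and>
     (AE \<omega> in S. W 0 \<omega> = 0) \<and>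
     (AE \<omega> in S. continuous_on {0..} (\<lambda>t. W t \<omega>)) \<and>
     (\<forall>s t. 0 \<le> s \<and> s < t \<longrightarrow>
        distributed S lborel (\<lambda>\<omega>. W t \<omega> - W s \<omega>) (\<lambda>x. ennreal (normal_density 0 (sqrt (t - s)) x))) \<and>
     (\<forall>n (p :: nat \<Rightarrow> real). 0 \<le> p 0 \<and> mono p \<longrightarrow>
        prob_space.indep_vars S (\<lambda>_. borel) (\<lambda>i \<omega>. W (p (Suc i)) \<omega> - W (p i) \<omega>) {..<n})"

text \<open>The intensity may be zero, in which case the process is almost surely constant zero (recall
  \<open>0 ^ 0 = 1\<close>); this is why the law of the increments is not expressed by \<open>poisson_pmf\<close>, which
  needs a positive rate.\<close>

definition poisson_process :: "'a measure \<Rightarrow> real \<Rightarrow> (real \<Rightarrow> 'a \<Rightarrow> nat) \<Rightarrow> bool" where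
  "poisson_process S lam P \<longleftrightarrow>
     (\<forall>t\<ge>0. P t \<in> measurable S (count_space UNIV)) \<and>
     (AE \<omega> in S. P 0 \<omega> = 0) \<and>
     (AE \<omega> in S. mono_on {0..} (\<lambda>t. P t \<omega>) \<and>
        (\<forall>t\<ge>0. continuous (at_right t) (\<lambda>s. real (P s \<omega>)))) \<and>
     (\<forall>s t k. 0 \<le> s \<and> s \<le> t \<longrightarrow>
        measure S {\<omega> \<in> space S. P t \<omega> = P s \<omega> + k}
          = (lam * (t - s)) ^ k / fact k * exp (- (lam * (t - s)))) \<and>
     (\<forall>n (p :: nat \<Rightarrow> real). 0 \<le> p 0 \<and> mono p \<longrightarrow>
        prob_space.indep_vars S (\<lambda>_. borel)
          (\<lambda>i \<omega>. real (P (p (Suc i)) \<omega>) - real (P (p i) \<omega>)) {..<n})"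

definition compound_sum :: "(real \<Rightarrow> 'a \<Rightarrow> nat) \<Rightarrow> (nat \<Rightarrow> 'a \<Rightarrow> real) \<Rightarrow> real \<Rightarrow> 'a \<Rightarrow> real" where
  "compound_sum P eta t \<omega> = (\<Sum>i = 1..P t \<omega>. eta i \<omega>)"

text \<open>To express joint independence of Brownian motions, Poisson processes and single jump sizes,
  all of them are regarded as random elements of the product space of real functions on
  \<open>{0..}\<close>; a jump size becomes a path that is constant in time and generates the same
  sigma-algebra as the jump size.\<close>

datatype 'j source = Brownian 'j | Counting 'j | Mark 'j nat

fun source_path :: "('j \<Rightarrow> real \<Rightarrow> 'a \<Rightarrow> real) \<Rightarrow> ('j \<Rightarrow> real \<Rightarrow> 'a \<Rightarrow> nat) \<Rightarrow> ('j \<Rightarrow> nat \<Rightarrow> 'a \<Rightarrow> real)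
    \<Rightarrow> 'j source \<Rightarrow> real \<Rightarrow> 'a \<Rightarrow> real" where
  "source_path W P eta (Brownian j) t \<omega> = W j t \<omega>"
| "source_path W P eta (Counting j) t \<omega> = real (P j t \<omega>)"
| "source_path W P eta (Mark j i) t \<omega> = eta j i \<omega>"

definition driving_noise :: "'a measure \<Rightarrow> 'j set \<Rightarrow> real \<Rightarrow> (real \<Rightarrow> real) \<Rightarrow>
    ('j \<Rightarrow> real \<Rightarrow> 'a \<Rightarrow> real) \<Rightarrow> ('j \<Rightarrow> real \<Rightarrow> 'a \<Rightarrow> nat) \<Rightarrow> ('j \<Rightarrow> nat \<Rightarrow> 'a \<Rightarrow> real) \<Rightarrow> bool" where
  "driving_noise S J lam F_eta W P eta \<longleftrightarrow>
     prob_space S \<and>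
     (\<forall>j\<in>J. brownian_motion S (W j)) \<and>
     (\<forall>j\<in>J. poisson_process S lam (P j)) \<and>
     (\<forall>j\<in>J. \<forall>i\<ge>1. eta j i \<in> borel_measurable S \<and> cdf (distr S borel (eta j i)) = F_eta) \<and>
     prob_space.indep_vars S (\<lambda>_. PiM {0..} (\<lambda>_. borel))
       (\<lambda>k \<omega>. \<lambda>t\<in>{0..}. source_path W P eta k t \<omega>)
       ({Brownian j |j. j \<in> J} \<union> {Counting j |j. j \<in> J} \<union> {Mark j i |j i. j \<in> J \<and> 1 \<le> i})"

section \<open>The Ito integral\<close>

definition converges_in_prob :: "'a measure \<Rightarrow> (nat \<Rightarrow> 'a \<Rightarrow> real) \<Rightarrow> ('a \<Rightarrow> real) \<Rightarrow> bool" where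
  "converges_in_prob S Z Z' \<longleftrightarrow>
     (\<forall>k. Z k \<in> borel_measurable S) \<and> Z' \<in> borel_measurable S \<and>
     (\<forall>\<epsilon>>0. (\<lambda>k. measure S {\<omega> \<in> space S. \<bar>Z k \<omega> - Z' \<omega>\<bar> > \<epsilon>}) \<longlonglongrightarrow> 0)"

text \<open>The filtration generated by a set of processes and augmented by the null sets.\<close>

definition augmented_filtration ::
    "'a measure \<Rightarrow> (real \<Rightarrow> 'a \<Rightarrow> real) set \<Rightarrow> real \<Rightarrow> 'a measure" where
  "augmented_filtration S \<Z> t =
     sigma (space S)
       ({Z s -` A \<inter> space S |Z s A. Z \<in> \<Z> \<and> 0 \<le> s \<and> s \<le> t \<and> A \<in> sets borel} \<union> null_sets S)"

definition progressive_upto ::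
    "(real \<Rightarrow> 'a measure) \<Rightarrow> real \<Rightarrow> (real \<Rightarrow> 'a \<Rightarrow> real) \<Rightarrow> bool" where
  "progressive_upto F t H \<longleftrightarrow>
     (\<forall>r. 0 \<le> r \<and> r \<le> t \<longrightarrow>
        (\<lambda>(u, \<omega>). H u \<omega>) \<in> borel_measurable (restrict_space borel {0..r} \<Otimes>\<^sub>M F r))"

text \<open>A simple process is given by a partition \<open>p 0 \<le> \<dots> \<le> p n\<close> and bounded \<open>F (p i)\<close>-measurable
  heights \<open>\<xi> i\<close> on \<open>{p i<..p (Suc i)}\<close>.\<close>

definition simple_process ::
    "(real \<Rightarrow> 'a measure) \<Rightarrow> nat \<Rightarrow> (nat \<Rightarrow> real) \<Rightarrow> (nat \<Rightarrow> 'a \<Rightarrow> real) \<Rightarrow> bool" where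
  "simple_process F n p \<xi> \<longleftrightarrow>
     0 \<le> p 0 \<and> (\<forall>i<n. p i \<le> p (Suc i)) \<and>
     (\<forall>i<n. \<xi> i \<in> borel_measurable (F (p i)) \<and> bounded (\<xi> i ` space (F (p i))))"

definition simple_value ::
    "nat \<Rightarrow> (nat \<Rightarrow> real) \<Rightarrow> (nat \<Rightarrow> 'a \<Rightarrow> real) \<Rightarrow> real \<Rightarrow> 'a \<Rightarrow> real" where
  "simple_value n p \<xi> u \<omega> = (\<Sum>i<n. \<xi> i \<omega> * indicator {p i<..p (Suc i)} u)"

definition simple_integral :: "(real \<Rightarrow> 'a \<Rightarrow> real) \<Rightarrow>
    nat \<Rightarrow> (nat \<Rightarrow> real) \<Rightarrow> (nat \<Rightarrow> 'a \<Rightarrow> real) \<Rightarrow> real \<Rightarrow> 'a \<Rightarrow> real" where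
  "simple_integral W n p \<xi> t \<omega> =
     (\<Sum>i<n. \<xi> i \<omega> * (W (min t (p (Suc i))) \<omega> - W (min t (p i)) \<omega>))"

text \<open>\<open>has_ito_integral S F W H t I\<close> says that \<open>I\<close> is (a version of) the integral of \<open>H\<close> with
  respect to \<open>W\<close> over \<open>{0..t}\<close>, for progressively measurable \<open>H\<close> with \<open>H\<^sup>2\<close> pathwise integrable.
  It is meant for filtrations \<open>F\<close> for which \<open>W\<close> is a Brownian motion; below, \<open>F\<close> is generated by
  \<open>W\<close> and processes independent of \<open>W\<close>.\<close>

definition has_ito_integral :: "'a measure \<Rightarrow> (real \<Rightarrow> 'a measure) \<Rightarrow> (real \<Rightarrow> 'a \<Rightarrow> real) \<Rightarrow>
    (real \<Rightarrow> 'a \<Rightarrow> real) \<Rightarrow> real \<Rightarrow> ('a \<Rightarrow> real) \<Rightarrow> bool" where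
  "has_ito_integral S F W H t I \<longleftrightarrow>
     progressive_upto F t H \<and>
     (AE \<omega> in S. set_integrable lborel {0..t} (\<lambda>u. (H u \<omega>)\<^sup>2)) \<and>
     (\<exists>n p \<xi>. (\<forall>k. simple_process F (n k) (p k) (\<xi> k)) \<and>
        converges_in_prob S
          (\<lambda>k \<omega>. LBINT u:{0..t}. (simple_value (n k) (p k) (\<xi> k) u \<omega> - H u \<omega>)\<^sup>2) (\<lambda>_. 0) \<and>
        converges_in_prob S (\<lambda>k. simple_integral W (n k) (p k) (\<xi> k) t) I)"

section \<open>Component and composite processes\<close>

text \<open>\<open>b\<close> and \<open>sig\<close> are the coefficients as functions of time only, i.e. with the parameter
  already inserted.\<close>

definition component_process :: "'a measure \<Rightarrow> (real \<Rightarrow> real) \<Rightarrow> (real \<Rightarrow> real) \<Rightarrow>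
    (real \<Rightarrow> 'a \<Rightarrow> real) \<Rightarrow> (real \<Rightarrow> 'a \<Rightarrow> nat) \<Rightarrow> (nat \<Rightarrow> 'a \<Rightarrow> real) \<Rightarrow> (real \<Rightarrow> 'a \<Rightarrow> real) \<Rightarrow> bool" where
  "component_process S b sig W P eta Y \<longleftrightarrow>
     (\<forall>t\<ge>0. Y t \<in> borel_measurable S \<and> set_integrable lborel {0..t} b \<and>
        (\<exists>I. has_ito_integral S (augmented_filtration S {W}) W (\<lambda>u _. sig u) t I \<and>
           (AE \<omega> in S. Y t \<omega> = (LBINT u:{0..t}. b u) + I \<omega> + compound_sum P eta t \<omega>)))"

text \<open>The switching times \<open>\<tau>\<close> are extended reals so that the last one can be infinite.\<close>

definition stopped_clock :: "(nat \<Rightarrow> ereal) \<Rightarrow> nat \<Rightarrow> real \<Rightarrow> real" where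
  "stopped_clock \<tau> j t =
     (if ereal t < \<tau> j then 0
      else if ereal t < \<tau> (Suc j) then t - real_of_ereal (\<tau> j)
      else real_of_ereal (\<tau> (Suc j)) - real_of_ereal (\<tau> j))"

definition composite_process :: "nat \<Rightarrow> real \<Rightarrow> (nat \<Rightarrow> ereal) \<Rightarrow>
    (nat \<Rightarrow> real \<Rightarrow> real \<Rightarrow> 'a \<Rightarrow> real) \<Rightarrow> (nat \<Rightarrow> real) \<Rightarrow> real \<Rightarrow> 'a \<Rightarrow> real" where
  "composite_process M x0 \<tau> Y \<theta> t \<omega> = x0 + (\<Sum>j\<le>M. Y j (\<theta> j) (stopped_clock \<tau> j t) \<omega>)"

text \<open>For \<open>c = b\<close> this is \<open>\<beta>(t; \<theta>)\<close>, for \<open>c = \<sigma>\<close> it is \<open>\<gamma>(t; \<theta>)\<close>.\<close>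

definition composite_coeff :: "nat \<Rightarrow> (nat \<Rightarrow> ereal) \<Rightarrow>
    (nat \<Rightarrow> real \<Rightarrow> real \<Rightarrow> real) \<Rightarrow> (nat \<Rightarrow> real) \<Rightarrow> real \<Rightarrow> real" where
  "composite_coeff M \<tau> c \<theta> t =
     (\<Sum>j\<le>M. c j (stopped_clock \<tau> j t) (\<theta> j) * of_bool (\<tau> j \<le> ereal t \<and> ereal t < \<tau> (Suc j)))"

section \<open>The local volatility process\<close>

definition has_pdf :: "'a measure \<Rightarrow> ('a \<Rightarrow> real) \<Rightarrow> (real \<Rightarrow> real) \<Rightarrow> bool" where
  "has_pdf S Z f \<longleftrightarrow> (\<forall>x. 0 \<le> f x) \<and> distributed S lborel Z (\<lambda>x. ennreal (f x))"

definition multi_indices :: "nat \<Rightarrow> (nat \<Rightarrow> nat) \<Rightarrow> (nat \<Rightarrow> nat) set" where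
  "multi_indices M N = (\<Pi>\<^sub>E j\<in>{..M}. {1..N j})"

definition multi_param :: "nat \<Rightarrow> (nat \<Rightarrow> nat \<Rightarrow> real) \<Rightarrow> (nat \<Rightarrow> nat) \<Rightarrow> nat \<Rightarrow> real" where
  "multi_param M \<theta> n = (\<lambda>j\<in>{..M}. \<theta> j (n j))"

definition multi_weight :: "nat \<Rightarrow> (nat \<Rightarrow> nat \<Rightarrow> real) \<Rightarrow> (nat \<Rightarrow> nat) \<Rightarrow> real" where
  "multi_weight M w n = (\<Prod>j\<le>M. w j (n j))"

text \<open>In the following, \<open>f \<theta> t x\<close> stands for the density at \<open>x\<close> of the composite process with
  parameter vector \<open>\<theta>\<close> at time \<open>t\<close>.\<close>

definition mixture_density :: "nat \<Rightarrow> (nat \<Rightarrow> nat) \<Rightarrow> (nat \<Rightarrow> nat \<Rightarrow> real) \<Rightarrow> (nat \<Rightarrow> nat \<Rightarrow> real) \<Rightarrow>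
    ((nat \<Rightarrow> real) \<Rightarrow> real \<Rightarrow> real \<Rightarrow> real) \<Rightarrow> real \<Rightarrow> real \<Rightarrow> real" where
  "mixture_density M N w \<theta> f t x =
     (\<Sum>n\<in>multi_indices M N. multi_weight M w n * f (multi_param M \<theta> n) t x)"

definition local_drift :: "nat \<Rightarrow> (nat \<Rightarrow> ereal) \<Rightarrow> (nat \<Rightarrow> real \<Rightarrow> real \<Rightarrow> real) \<Rightarrow>
    (nat \<Rightarrow> nat) \<Rightarrow> (nat \<Rightarrow> nat \<Rightarrow> real) \<Rightarrow> (nat \<Rightarrow> nat \<Rightarrow> real) \<Rightarrow>
    ((nat \<Rightarrow> real) \<Rightarrow> real \<Rightarrow> real \<Rightarrow> real) \<Rightarrow> real \<Rightarrow> real \<Rightarrow> real" where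
  "local_drift M \<tau> b N w \<theta> f t x =
     (\<Sum>n\<in>multi_indices M N. multi_weight M w n
        * composite_coeff M \<tau> b (multi_param M \<theta> n) t * f (multi_param M \<theta> n) t x)
     / mixture_density M N w \<theta> f t x"

definition local_vol :: "nat \<Rightarrow> (nat \<Rightarrow> ereal) \<Rightarrow> (nat \<Rightarrow> real \<Rightarrow> real \<Rightarrow> real) \<Rightarrow>
    (nat \<Rightarrow> nat) \<Rightarrow> (nat \<Rightarrow> nat \<Rightarrow> real) \<Rightarrow> (nat \<Rightarrow> nat \<Rightarrow> real) \<Rightarrow>
    ((nat \<Rightarrow> real) \<Rightarrow> real \<Rightarrow> real \<Rightarrow> real) \<Rightarrow> real \<Rightarrow> real \<Rightarrow> real" where
  "local_vol M \<tau> sig N w \<theta> f t x =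
     sqrt ((\<Sum>n\<in>multi_indices M N. multi_weight M w n
        * (composite_coeff M \<tau> sig (multi_param M \<theta> n) t)\<^sup>2 * f (multi_param M \<theta> n) t x)
     / mixture_density M N w \<theta> f t x)"

text \<open>Strong solution of \<open>dX = \<mu>(t, X) dt + \<sigma>(t, X) dW + d(\<Sum>i\<le>P t. eta i)\<close>, \<open>X 0 = x0\<close>: a cadlag
  process adapted to the augmented filtration of the given noise. Since both sides are cadlag, the
  integral equation may be required at each time separately.\<close>

definition strong_solution :: "'a measure \<Rightarrow> (real \<Rightarrow> 'a \<Rightarrow> real) \<Rightarrow> (real \<Rightarrow> 'a \<Rightarrow> nat) \<Rightarrow>
    (nat \<Rightarrow> 'a \<Rightarrow> real) \<Rightarrow> (real \<Rightarrow> real \<Rightarrow> real) \<Rightarrow> (real \<Rightarrow> real \<Rightarrow> real) \<Rightarrow> real \<Rightarrow>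
    (real \<Rightarrow> 'a \<Rightarrow> real) \<Rightarrow> bool" where
  "strong_solution S W P eta \<mu> \<sigma> x0 X \<longleftrightarrow>
     (let F = augmented_filtration S {W, \<lambda>t \<omega>. real (P t \<omega>), compound_sum P eta} in
      (\<forall>t\<ge>0. X t \<in> borel_measurable (F t)) \<and>
      (AE \<omega> in S. X 0 \<omega> = x0) \<and>
      (AE \<omega> in S. (\<forall>t\<ge>0. continuous (at_right t) (\<lambda>s. X s \<omega>)) \<and>
                  (\<forall>t>0. \<exists>l. ((\<lambda>s. X s \<omega>) \<longlongrightarrow> l) (at_left t))) \<and>
      (\<forall>t\<ge>0. progressive_upto F t (\<lambda>u \<omega>. \<mu> u (X u \<omega>)) \<and>
         (AE \<omega> in S. set_integrable lborel {0..t} (\<lambda>u. \<mu> u (X u \<omega>))) \<and>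
         (\<exists>I. has_ito_integral S F W (\<lambda>u \<omega>. \<sigma> u (X u \<omega>)) t I \<and>
            (AE \<omega> in S. X t \<omega> = x0 + (LBINT u:{0..t}. \<mu> u (X u \<omega>)) + I \<omega>
                                + compound_sum P eta t \<omega>))))"

definition unique_strong_solution :: "'a measure \<Rightarrow> (real \<Rightarrow> 'a \<Rightarrow> real) \<Rightarrow> (real \<Rightarrow> 'a \<Rightarrow> nat) \<Rightarrow>
    (nat \<Rightarrow> 'a \<Rightarrow> real) \<Rightarrow> (real \<Rightarrow> real \<Rightarrow> real) \<Rightarrow> (real \<Rightarrow> real \<Rightarrow> real) \<Rightarrow> real \<Rightarrow>
    (real \<Rightarrow> 'a \<Rightarrow> real) \<Rightarrow> bool" where
  "unique_strong_solution S W P eta \<mu> \<sigma> x0 X \<longleftrightarrow>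
     strong_solution S W P eta \<mu> \<sigma> x0 X \<and>
     (\<forall>X'. strong_solution S W P eta \<mu> \<sigma> x0 X' \<longrightarrow> (AE \<omega> in S. \<forall>t\<ge>0. X' t \<omega> = X t \<omega>))"

end

theory Submission
  imports Defs
begin

text \<open>For \<open>t > 0\<close> the density of \<open>X t\<close> is a mixture of densities of composite processes, so by
  linearity its characteristic function is the same mixture of characteristic functions. A composite
  process is a sum of components driven by disjoint groups of sources, and each component is
  measurable with respect to the completed sigma-algebra of its own group, since its stochastic
  integral is a limit in probability of simple integrals; hence the components are independent and
  the characteristic functions multiply. The sum over multi-indices then factorises. At \<open>t = 0\<close>,
  where no density exists, both sides are computed directly.\<close>

section \<open>Completion of sigma-algebras by null sets, and independence\<close>

text \<open>Only null sets of \<open>S\<close> itself are adjoined; \<open>S\<close> need not be complete.\<close>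

definition augmented_sets :: "'a measure \<Rightarrow> 'a set set \<Rightarrow> 'a set set" where
  "augmented_sets S A = {B \<in> sets S. \<exists>C\<in>A. AE x in S. x \<in> B \<longleftrightarrow> x \<in> C}"

lemma augmented_setsI: "B \<in> sets S \<Longrightarrow> C \<in> A \<Longrightarrow> AE x in S. x \<in> B \<longleftrightarrow> x \<in> C \<Longrightarrow> B \<in> augmented_sets S A"
  by (auto simp: augmented_sets_def)

lemma augmented_sets_superset: "A \<subseteq> sets S \<Longrightarrow> A \<subseteq> augmented_sets S A"
  by (auto simp: augmented_sets_def)

lemma augmented_sets_subset: "augmented_sets S A \<subseteq> sets S"
  by (auto simp: augmented_sets_def)

lemma augmented_sets_AE:
  assumes "B \<in> augmented_sets S A" "B' \<in> sets S" "AE x in S. x \<in> B' \<longleftrightarrow> x \<in> B"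
  shows "B' \<in> augmented_sets S A"
proof -
  obtain C where C: "C \<in> A" "AE x in S. x \<in> B \<longleftrightarrow> x \<in> C"
    using assms(1) by (auto simp: augmented_sets_def)
  have "AE x in S. x \<in> B' \<longleftrightarrow> x \<in> C" using C(2) assms(3) by eventually_elim simp
  then show ?thesis using C(1) assms(2) by (auto intro: augmented_setsI)
qed

text \<open>Almost everywhere equality survives complements and, since countably many null sets have
  a null union, countable unions.\<close>

lemma sigma_algebra_augmented_sets:
  assumes A: "sigma_algebra (space S) A"
  shows "sigma_algebra (space S) (augmented_sets S A)"
proof -
  interpret A: sigma_algebra "space S" A by fact
  show ?thesis unfolding sigma_algebra_iff2
  proof (intro conjI ballI allI impI)
    show "augmented_sets S A \<subseteq> Pow (space S)"
      using sets.space_closed by (auto simp: augmented_sets_def)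
    show "{} \<in> augmented_sets S A" by (rule augmented_setsI[where C="{}"]) auto
    fix B assume "B \<in> augmented_sets S A"
    then obtain C where B: "B \<in> sets S" and C: "C \<in> A" "AE x in S. x \<in> B \<longleftrightarrow> x \<in> C"
      by (auto simp: augmented_sets_def)
    have "AE x in S. x \<in> space S - B \<longleftrightarrow> x \<in> space S - C"
      using C(2) by eventually_elim auto
    then show "space S - B \<in> augmented_sets S A"
      using B C(1) by (auto intro!: augmented_setsI[where C="space S - C"])
  next
    fix B :: "nat \<Rightarrow> 'a set" assume B: "range B \<subseteq> augmented_sets S A"
    then have "\<forall>i. \<exists>C\<in>A. AE x in S. x \<in> B i \<longleftrightarrow> x \<in> C" by (auto simp: augmented_sets_def)
    then obtain C where C: "\<And>i. C i \<in> A" "\<And>i. AE x in S. x \<in> B i \<longleftrightarrow> x \<in> C i" by metis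
    have "AE x in S. \<forall>i. x \<in> B i \<longleftrightarrow> x \<in> C i" using C(2) by (simp add: AE_all_countable)
    then have "AE x in S. x \<in> (\<Union>i. B i) \<longleftrightarrow> x \<in> (\<Union>i. C i)" by eventually_elim auto
    moreover have "(\<Union>i. B i) \<in> sets S" using B augmented_sets_subset[of S A] by (intro sets.countable_UN) blast
    moreover have "(\<Union>i. C i) \<in> A" using C(1) by (intro A.countable_UN) auto
    ultimately show "(\<Union>i. B i) \<in> augmented_sets S A" by (auto intro!: augmented_setsI)
  qed
qed

text \<open>Replacing each \<open>B j\<close> by an a.e. equal \<open>C j\<close> from
  \<open>A j\<close> changes a finite intersection only by a null set, so the product formula for
  the \<open>C j\<close> carries over.\<close>

lemma (in prob_space) indep_sets_augmented_sets:
  assumes A: "indep_sets A I"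
  shows "indep_sets (\<lambda>i. augmented_sets M (A i)) I"
proof (rule indep_setsI)
  show "augmented_sets M (A i) \<subseteq> events" for i by (rule augmented_sets_subset)
  fix B J assume J: "J \<noteq> {}" "J \<subseteq> I" "finite J" "\<forall>j\<in>J. B j \<in> augmented_sets M (A j)"
  then have "\<forall>j\<in>J. \<exists>C\<in>A j. AE x in M. x \<in> B j \<longleftrightarrow> x \<in> C" by (auto simp: augmented_sets_def)
  then obtain C where C: "\<And>j. j \<in> J \<Longrightarrow> C j \<in> A j" "\<And>j. j \<in> J \<Longrightarrow> AE x in M. x \<in> B j \<longleftrightarrow> x \<in> C j"
    by metis
  have Bs: "B j \<in> events" if "j \<in> J" for j using J that by (auto simp: augmented_sets_def)
  have Cs: "C j \<in> events" if "j \<in> J" for j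
    using A J(2) C(1) that unfolding indep_sets_def by blast
  have "AE x in M. \<forall>j\<in>J. x \<in> B j \<longleftrightarrow> x \<in> C j" using C(2) J(3) by (simp add: AE_finite_all)
  then have "AE x in M. x \<in> (\<Inter>j\<in>J. B j) \<longleftrightarrow> x \<in> (\<Inter>j\<in>J. C j)" by eventually_elim auto
  then have "prob (\<Inter>j\<in>J. B j) = prob (\<Inter>j\<in>J. C j)"
    using J Bs Cs by (intro finite_measure_eq_AE sets.finite_INT) auto
  also have "\<dots> = (\<Prod>j\<in>J. prob (C j))" using A J C(1) by (intro indep_setsD) auto
  also have "\<dots> = (\<Prod>j\<in>J. prob (B j))"
  proof (rule prod.cong[OF refl])
    show "prob (C j) = prob (B j)" if "j \<in> J" for j
      using C(2)[OF that] Bs[OF that] Cs[OF that]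
      by (intro finite_measure_eq_AE) (auto simp: eq_commute)
  qed
  finally show "prob (\<Inter>j\<in>J. B j) = (\<Prod>j\<in>J. prob (B j))" .
qed

text \<open>\<open>sigma\<close> carries the zero measure, so this object serves only for
  measurability; all a.e. statements remain relative to \<open>S\<close>.\<close>

definition augmented_sigma :: "'a measure \<Rightarrow> 'a set set \<Rightarrow> 'a measure" where
  "augmented_sigma S A = sigma (space S) (augmented_sets S (sigma_sets (space S) A))"

lemma space_augmented_sigma [simp]: "space (augmented_sigma S A) = space S"
  unfolding augmented_sigma_def
  by (rule space_measure_of) (use augmented_sets_subset sets.space_closed in blast)

lemma sets_augmented_sigma:
  assumes "A \<subseteq> sets S"
  shows "sets (augmented_sigma S A) = augmented_sets S (sigma_sets (space S) A)"
  unfolding augmented_sigma_def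
  using assms sets.space_closed[of S]
  by (intro sigma_algebra.sets_measure_of_eq sigma_algebra_augmented_sets sigma_algebra_sigma_sets) blast

lemma sets_augmented_sigma_superset:
  assumes "A \<subseteq> sets S" shows "A \<subseteq> sets (augmented_sigma S A)"
  unfolding sets_augmented_sigma[OF assms]
  using augmented_sets_superset[OF sets.sigma_sets_subset[OF assms]] by auto

lemma null_sets_augmented_sigma:
  assumes "A \<subseteq> sets S" shows "null_sets S \<subseteq> sets (augmented_sigma S A)"
proof
  fix B assume B: "B \<in> null_sets S"
  then have "AE x in S. x \<in> B \<longleftrightarrow> x \<in> {}" using AE_not_in[OF B] by auto
  then show "B \<in> sets (augmented_sigma S A)"
    unfolding sets_augmented_sigma[OF assms] using B
    by (auto intro: augmented_setsI[where C="{}"] sigma_sets.Empty)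
qed

text \<open>The point of the completion: a function determined only up to null sets, such as a
  stochastic integral, can still be measurable in a small sigma-algebra. Measurability of
  \<open>g\<close> in \<open>S\<close> is assumed separately because \<open>S\<close> may be
  incomplete.\<close>

lemma augmented_sigma_measurable_cong_AE:
  assumes A: "A \<subseteq> sets S" and f: "f \<in> measurable (augmented_sigma S A) N"
    and g: "g \<in> measurable S N" and eq: "AE x in S. g x = f x"
  shows "g \<in> measurable (augmented_sigma S A) N"
proof (rule measurableI)
  show "x \<in> space (augmented_sigma S A) \<Longrightarrow> g x \<in> space N" for x
    using measurable_space[OF g] by simp
  fix B assume B: "B \<in> sets N"
  have "f -` B \<inter> space S \<in> augmented_sets S (sigma_sets (space S) A)"
    using measurable_sets[OF f B] by (simp add: sets_augmented_sigma[OF A])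
  moreover have "AE x in S. x \<in> g -` B \<inter> space S \<longleftrightarrow> x \<in> f -` B \<inter> space S"
    using eq by eventually_elim auto
  ultimately show "g -` B \<inter> space (augmented_sigma S A) \<in> sets (augmented_sigma S A)"
    using measurable_sets[OF g B] by (auto simp: sets_augmented_sigma[OF A] intro: augmented_sets_AE)
qed

section \<open>Limits in probability\<close>

text \<open>Choose \<open>r m\<close> so that the deviation exceeds \<open>(1/2) ^ m\<close> with
  measure below \<open>(1/2) ^ m\<close>; these bounds are summable, and Borel-Cantelli applies. The
  selection \<open>r\<close> may fail to be increasing.\<close>

lemma converges_in_prob_AE_subseq:
  assumes "finite_measure S" and conv: "converges_in_prob S Z L"
  obtains r :: "nat \<Rightarrow> nat" where "AE x in S. (\<lambda>k. Z (r k) x) \<longlonglongrightarrow> L x"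
proof -
  interpret finite_measure S by fact
  have [measurable]: "\<And>k. Z k \<in> borel_measurable S" "L \<in> borel_measurable S"
    using conv by (auto simp: converges_in_prob_def)
  have "\<exists>k. measure S {x \<in> space S. \<bar>Z k x - L x\<bar> > (1/2) ^ m} < (1/2) ^ m" for m :: nat
  proof -
    have "(\<lambda>k. measure S {x \<in> space S. \<bar>Z k x - L x\<bar> > (1/2) ^ m}) \<longlonglongrightarrow> 0"
      using conv by (simp add: converges_in_prob_def)
    then have "\<forall>\<^sub>F k in sequentially. measure S {x \<in> space S. \<bar>Z k x - L x\<bar> > (1/2) ^ m} < (1/2) ^ m"
      by (rule order_tendstoD) simp
    then show ?thesis by (auto simp: eventually_sequentially)
  qed
  then obtain r where r: "\<And>m. measure S {x \<in> space S. \<bar>Z (r m) x - L x\<bar> > (1/2) ^ m} < (1/2) ^ m"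
    by metis
  have "AE x in S. eventually (\<lambda>m. x \<in> space S - {x \<in> space S. \<bar>Z (r m) x - L x\<bar> > (1/2) ^ m}) sequentially"
  proof (rule borel_cantelli_AE1)
    show "summable (\<lambda>m. measure S {x \<in> space S. \<bar>Z (r m) x - L x\<bar> > (1/2) ^ m})"
      by (rule summable_comparison_test'[OF summable_geometric[of "1/2"], where N=0])
        (simp_all add: less_imp_le[OF r])
  qed (auto simp: less_top[symmetric])
  then have "AE x in S. (\<lambda>k. Z (r k) x) \<longlonglongrightarrow> L x"
  proof eventually_elim
    case (elim x)
    then have "\<forall>\<^sub>F m in sequentially. norm (Z (r m) x - L x) \<le> (1/2) ^ m"
      by eventually_elim auto
    moreover have "(\<lambda>m. (1/2::real) ^ m) \<longlonglongrightarrow> 0" by (simp add: LIMSEQ_realpow_zero)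
    ultimately have "(\<lambda>m. Z (r m) x - L x) \<longlonglongrightarrow> 0" by (rule Lim_null_comparison)
    then show ?case by (simp add: LIM_zero_iff)
  qed
  then show ?thesis by (rule that)
qed

lemma augmented_sigma_measurable_converges_in_prob:
  assumes "finite_measure S" and A: "A \<subseteq> sets S" and conv: "converges_in_prob S Z L"
    and Z: "\<And>k. Z k \<in> borel_measurable (augmented_sigma S A)"
  shows "L \<in> borel_measurable (augmented_sigma S A)"
proof -
  obtain r where r: "AE x in S. (\<lambda>k. Z (r k) x) \<longlonglongrightarrow> L x"
    using converges_in_prob_AE_subseq[OF assms(1) conv] by blast
  show ?thesis
  proof (rule augmented_sigma_measurable_cong_AE[OF A])
    \<comment> \<open>\<open>lim\<close> is total, hence gives a measurable candidate everywhere; it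
      equals \<open>L\<close> wherever the selected sequence converges to \<open>L\<close>.\<close>
    show "(\<lambda>x. lim (\<lambda>k. Z (r k) x)) \<in> borel_measurable (augmented_sigma S A)"
      using Z by (intro borel_measurable_lim_metric)
    show "L \<in> borel_measurable S" using conv by (simp add: converges_in_prob_def)
    show "AE x in S. L x = lim (\<lambda>k. Z (r k) x)"
      using r by eventually_elim (simp add: limI)
  qed
qed

section \<open>Measurability of component processes\<close>

text \<open>All generators of the augmented filtration lie in \<open>H\<close>: the events of past
  values by the last assumption, the null sets by the third. This carries adapted functions into
  \<open>H\<close>.\<close>

lemma measurable_augmented_filtration:
  assumes f: "f \<in> borel_measurable (augmented_filtration S \<Z> t)" and "space H = space S"
    and "null_sets S \<subseteq> sets H"
    and Z: "\<And>Z s. Z \<in> \<Z> \<Longrightarrow> 0 \<le> s \<Longrightarrow> Z s \<in> borel_measurable H"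
  shows "f \<in> borel_measurable H"
proof -
  let ?G = "{Z s -` A \<inter> space S |Z s A. Z \<in> \<Z> \<and> 0 \<le> s \<and> s \<le> t \<and> A \<in> sets borel} \<union> null_sets S"
  have "Z s -` A \<inter> space S \<in> sets H" if "Z \<in> \<Z>" "0 \<le> s" "A \<in> sets borel" for Z s A
    using measurable_sets[OF Z[OF that(1,2)] that(3)] assms(2) by simp
  then have "?G \<subseteq> sets H" using assms(3) by blast
  then have "sigma_sets (space S) ?G \<subseteq> sets H"
    using sets.sigma_sets_subset[of ?G H] assms(2) by simp
  moreover have G: "?G \<subseteq> Pow (space S)" using sets.space_closed[of S] by (auto simp: null_sets_def)
  ultimately have "sets (augmented_filtration S \<Z> t) \<subseteq> sets H"
    unfolding augmented_filtration_def by (simp add: sets_measure_of)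
  moreover have "space (augmented_filtration S \<Z> t) = space S"
    unfolding augmented_filtration_def by (rule space_measure_of[OF G])
  ultimately show ?thesis using f assms(2) by (auto simp: measurable_def)
qed

lemma simple_process_nonneg: "simple_process F n p \<xi> \<Longrightarrow> i \<le> n \<Longrightarrow> 0 \<le> p i"
proof (induction i)
  case (Suc i)
  then have "0 \<le> p i" "p i \<le> p (Suc i)" by (auto simp: simple_process_def)
  then show ?case by simp
qed (simp add: simple_process_def)

text \<open>The random upper limit takes countably many values, so sums of fixed length are glued
  along the events \<open>P t = k\<close>. The count enters as a real function because
  \<open>source_path\<close> supplies it that way.\<close>

lemma compound_sum_measurable:
  assumes [measurable]: "(\<lambda>\<omega>. real (P t \<omega>)) \<in> borel_measurable H"
    and eta: "\<And>i. 1 \<le> i \<Longrightarrow> eta i \<in> borel_measurable H"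
  shows "compound_sum P eta t \<in> borel_measurable H"
proof -
  have "{\<omega> \<in> space H. P t \<omega> = k} \<in> sets H" for k
  proof -
    have "{\<omega> \<in> space H. real (P t \<omega>) = real k} \<in> sets H" by measurable
    then show ?thesis by simp
  qed
  then have "P t \<in> measurable H (count_space UNIV)"
    by (intro measurable_count_space_eq2_countable[THEN iffD2]) (simp_all add: vimage_def Int_def conj_commute)
  moreover have "(\<lambda>\<omega>. \<Sum>i = 1..k. eta i \<omega>) \<in> borel_measurable H" for k
    by (rule borel_measurable_sum) (simp add: eta)
  ultimately show ?thesis
    unfolding compound_sum_def[abs_def]
    by (rule measurable_compose_countable[where f="\<lambda>k \<omega>. \<Sum>i = 1..k. eta i \<omega>", rotated])
qed

text \<open>The drift is a constant, the Ito integral a limit in probability of simple integrals,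
  and the jump part a compound sum; the completed sigma-algebra is closed under all these
  operations.\<close>

lemma component_process_measurable:
  assumes "finite_measure S" and A: "A \<subseteq> sets S"
    and Y: "component_process S b sig W P eta Y" and t: "0 \<le> t"
    and W: "\<And>s. 0 \<le> s \<Longrightarrow> W s \<in> borel_measurable (augmented_sigma S A)"
    and P: "\<And>s. 0 \<le> s \<Longrightarrow> (\<lambda>\<omega>. real (P s \<omega>)) \<in> borel_measurable (augmented_sigma S A)"
    and eta: "\<And>i. 1 \<le> i \<Longrightarrow> eta i \<in> borel_measurable (augmented_sigma S A)"
  shows "Y t \<in> borel_measurable (augmented_sigma S A)"
proof -
  let ?H = "augmented_sigma S A"
  obtain I where Yt: "Y t \<in> borel_measurable S"
    and I: "has_ito_integral S (augmented_filtration S {W}) W (\<lambda>u _. sig u) t I"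
    and eq: "AE \<omega> in S. Y t \<omega> = (LBINT u:{0..t}. b u) + I \<omega> + compound_sum P eta t \<omega>"
    using Y t unfolding component_process_def by blast
  obtain n p \<xi> where s: "\<And>k. simple_process (augmented_filtration S {W}) (n k) (p k) (\<xi> k)"
    and conv: "converges_in_prob S (\<lambda>k. simple_integral W (n k) (p k) (\<xi> k) t) I"
    using I unfolding has_ito_integral_def by blast
  have [measurable]: "I \<in> borel_measurable ?H"
  proof (rule augmented_sigma_measurable_converges_in_prob[OF assms(1) A conv])
    fix k
    \<comment> \<open>The heights are adapted to the filtration of \<open>W\<close> alone, whose
      generators all lie in \<open>?H\<close>.\<close>
    have xi: "\<xi> k i \<in> borel_measurable ?H" if "i < n k" for i
    proof (rule measurable_augmented_filtration)
      show "\<xi> k i \<in> borel_measurable (augmented_filtration S {W} (p k i))"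
        using s[of k] that by (simp add: simple_process_def)
    qed (use W null_sets_augmented_sigma[OF A] in auto)
    \<comment> \<open>\<open>W\<close> is controlled only at nonnegative times, so the truncated
      partition points must be nonnegative.\<close>
    have pp: "0 \<le> p k i" if "i \<le> n k" for i using simple_process_nonneg[OF s that] .
    show "simple_integral W (n k) (p k) (\<xi> k) t \<in> borel_measurable ?H"
      unfolding simple_integral_def[abs_def]
    proof (rule borel_measurable_sum)
      fix i assume "i \<in> {..<n k}"
      then have "i < n k" "0 \<le> min t (p k i)" "0 \<le> min t (p k (Suc i))"
        using pp[of i] pp[of "Suc i"] t by auto
      then show "(\<lambda>\<omega>. \<xi> k i \<omega> * (W (min t (p k (Suc i))) \<omega> - W (min t (p k i)) \<omega>)) \<in> borel_measurable ?H"
        using xi W by (intro borel_measurable_times borel_measurable_diff) auto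
    qed
  qed
  have [measurable]: "compound_sum P eta t \<in> borel_measurable ?H"
    using P t eta by (intro compound_sum_measurable) auto
  show ?thesis
    by (rule augmented_sigma_measurable_cong_AE[OF A _ Yt eq]) simp
qed

text \<open>All simple integrals up to time 0 vanish, hence so does their limit; the drift is an
  integral over a single point, and the jump sum is almost surely empty.\<close>

lemma component_process_0:
  assumes "finite_measure S" and Y: "component_process S b sig W P eta Y" and P: "AE \<omega> in S. P 0 \<omega> = 0"
  shows "AE \<omega> in S. Y 0 \<omega> = 0"
proof -
  obtain I where I: "has_ito_integral S (augmented_filtration S {W}) W (\<lambda>u _. sig u) 0 I"
    and eq: "AE \<omega> in S. Y 0 \<omega> = (LBINT u:{0..0}. b u) + I \<omega> + compound_sum P eta 0 \<omega>"
    using Y unfolding component_process_def by blast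
  obtain n p \<xi> where s: "\<And>k. simple_process (augmented_filtration S {W}) (n k) (p k) (\<xi> k)"
    and conv: "converges_in_prob S (\<lambda>k. simple_integral W (n k) (p k) (\<xi> k) 0) I"
    using I unfolding has_ito_integral_def by blast
  \<comment> \<open>Partition points are nonnegative, so both arguments of \<open>W\<close> collapse
    to 0 and every increment cancels.\<close>
  have 0: "simple_integral W (n k) (p k) (\<xi> k) 0 = (\<lambda>_. 0)" for k
    using simple_process_nonneg[OF s[of k]] by (auto simp: simple_integral_def fun_eq_iff min_absorb1)
  obtain r where "AE \<omega> in S. (\<lambda>k. simple_integral W (n (r k)) (p (r k)) (\<xi> (r k)) 0 \<omega>) \<longlonglongrightarrow> I \<omega>"
    using converges_in_prob_AE_subseq[OF assms(1) conv] by blast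
  then have I0: "AE \<omega> in S. I \<omega> = 0"
    by eventually_elim (auto simp: 0 LIMSEQ_const_iff)
  have b0: "(LBINT u:{0::real}. b u) = 0"
    unfolding set_lebesgue_integral_def
    by (rule integral_eq_zero_AE, rule AE_mp[OF AE_lborel_singleton[of 0]]) simp
  show ?thesis using I0 eq P by eventually_elim (simp add: b0 compound_sum_def)
qed

section \<open>Independence of the components\<close>

fun source_owner :: "'j source \<Rightarrow> 'j" where
  "source_owner (Brownian j) = j"
| "source_owner (Counting j) = j"
| "source_owner (Mark j i) = j"

text \<open>Sources are grouped by the component they drive. Independence of the source paths passes
  to the groups, then to their completions, and \<open>Y j (s j)\<close> is measurable in the
  completion of group \<open>j\<close>.\<close>

lemma indep_components:
  fixes Y :: "'j \<Rightarrow> real \<Rightarrow> 'a \<Rightarrow> real"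
  assumes noise: "driving_noise S J lam F_eta W P eta"
    and Y: "\<And>j. j \<in> J \<Longrightarrow> component_process S (b j) (sig j) (W j) (P j) (eta j) (Y j)"
    and s: "\<And>j. j \<in> J \<Longrightarrow> 0 \<le> s j"
  shows "prob_space.indep_vars S (\<lambda>_. borel) (\<lambda>j. Y j (s j)) J"
proof -
  interpret prob_space S using noise by (simp add: driving_noise_def)
  let ?D = "{Brownian j |j. j \<in> J} \<union> {Counting j |j. j \<in> J} \<union> {Mark j i |j i. j \<in> J \<and> 1 \<le> i}"
  let ?path = "\<lambda>k \<omega>. \<lambda>t\<in>{0..}. source_path W P eta k t \<omega>"
  define E where "E k = {?path k -` B \<inter> space S |B. B \<in> sets (PiM {0..} (\<lambda>_. borel))}" for k
  define D where "D j = {k \<in> ?D. source_owner k = j}" for j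
  define A where "A j = (\<Union>k\<in>D j. E k)" for j
  have iv: "indep_vars (\<lambda>_. PiM {0..} (\<lambda>_. borel)) ?path ?D"
    using noise by (simp add: driving_noise_def)
  have D_Un: "(\<Union>j\<in>J. D j) = ?D" unfolding D_def by force
  have E: "indep_sets E (\<Union>j\<in>J. D j)" using iv unfolding indep_vars_def2 D_Un E_def by simp
  then have "indep_sets (\<lambda>j. sigma_sets (space S) (A j)) J"
    unfolding A_def
  \<comment> \<open>Each \<open>E k\<close> consists of all preimages under one path map, hence is
    stable under intersection; \<open>source_owner\<close> keeps the groups disjoint.\<close>
  proof (rule indep_sets_collect_sigma)
    show "Int_stable (E k)" for k
    proof (rule Int_stableI)
      fix a b assume "a \<in> E k" "b \<in> E k"
      then obtain B C where "B \<in> sets (PiM {0..} (\<lambda>_. borel))" "C \<in> sets (PiM {0..} (\<lambda>_. borel))"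
        "a = ?path k -` B \<inter> space S" "b = ?path k -` C \<inter> space S" unfolding E_def by blast
      then show "a \<inter> b \<in> E k" unfolding E_def by (intro CollectI exI[of _ "B \<inter> C"]) auto
    qed
    show "disjoint_family_on D J" by (auto simp: disjoint_family_on_def D_def)
  qed
  then have indep: "indep_sets (\<lambda>j. augmented_sets S (sigma_sets (space S) (A j))) J"
    by (rule indep_sets_augmented_sets)
  have A: "A j \<subseteq> events" if "j \<in> J" for j
    using E that unfolding indep_sets_def A_def by blast
  have src: "source_path W P eta k t \<in> borel_measurable (augmented_sigma S (A j))"
    if "j \<in> J" "k \<in> D j" "0 \<le> t" for j k t
  proof (rule measurableI)
    fix B :: "real set" assume B: "B \<in> sets borel"
    \<comment> \<open>The value at \<open>t\<close> is a coordinate of the path, so its events are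
      preimages of cylinder sets; \<open>0 \<le> t\<close> ensures that restricting the path leaves
      this value intact.\<close>
    have "(\<lambda>x. x t) -` B \<inter> space (PiM {0..} (\<lambda>_. borel)) \<in> sets (PiM {0..} (\<lambda>_. borel))"
      using that B by (intro measurable_sets[OF measurable_component_singleton]) auto
    moreover have "source_path W P eta k t -` B \<inter> space S
        = ?path k -` ((\<lambda>x. x t) -` B \<inter> space (PiM {0..} (\<lambda>_. borel))) \<inter> space S"
      using that by (auto simp: space_PiM)
    ultimately have "source_path W P eta k t -` B \<inter> space S \<in> A j"
      using that(2) unfolding A_def E_def by blast
    then show "source_path W P eta k t -` B \<inter> space (augmented_sigma S (A j)) \<in> sets (augmented_sigma S (A j))"
      using sets_augmented_sigma_superset[OF A[OF that(1)]] by auto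
  qed simp
  have meas: "Y j (s j) \<in> borel_measurable (augmented_sigma S (A j))" if "j \<in> J" for j
  proof (rule component_process_measurable[OF _ A[OF that] Y[OF that] s[OF that]])
    show "finite_measure S" by unfold_locales
    show "W j t \<in> borel_measurable (augmented_sigma S (A j))" if "0 \<le> t" for t
      using src[of j "Brownian j" t] that \<open>j \<in> J\<close> by (simp add: D_def source_path.simps[abs_def])
    show "(\<lambda>\<omega>. real (P j t \<omega>)) \<in> borel_measurable (augmented_sigma S (A j))" if "0 \<le> t" for t
      using src[of j "Counting j" t] that \<open>j \<in> J\<close> by (simp add: D_def source_path.simps[abs_def])
    \<comment> \<open>A mark is a path constant in time, so evaluation at any nonnegative time, here
      0, recovers it.\<close>
    show "eta j i \<in> borel_measurable (augmented_sigma S (A j))" if "1 \<le> i" for i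
      using src[of j "Mark j i" 0] that \<open>j \<in> J\<close> by (simp add: D_def source_path.simps[abs_def])
  qed
  show ?thesis unfolding indep_vars_def2
  proof (intro conjI ballI)
    show "random_variable borel (Y j (s j))" if "j \<in> J" for j
      using Y[OF that] s[OF that] by (simp add: component_process_def)
    show "indep_sets (\<lambda>j. {Y j (s j) -` B \<inter> space S |B. B \<in> sets borel}) J"
    proof (rule indep_sets_mono_sets[OF indep])
      fix j assume "j \<in> J"
      then show "{Y j (s j) -` B \<inter> space S |B. B \<in> sets borel}
          \<subseteq> augmented_sets S (sigma_sets (space S) (A j))"
        using measurable_sets[OF meas[of j]] by (auto simp: sets_augmented_sigma[OF A])
    qed
  qed
qed

section \<open>Characteristic functions from densities, shifts and constants\<close>

lemma char_has_pdf:
  assumes "has_pdf S Z f"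
  shows "char (distr S borel Z) u = (CLINT x|lborel. f x *\<^sub>R iexp (u * x))"
proof -
  have d: "distributed S lborel Z (\<lambda>x. ennreal (f x))" and f: "\<And>x. 0 \<le> f x"
    using assms by (auto simp: has_pdf_def)
  have [measurable]: "f \<in> borel_measurable borel"
    using distributed_real_measurable[OF _ d] f by simp
  have "distr S borel Z = distr S lborel Z" by (rule distr_cong) auto
  also have "\<dots> = density lborel f" by (rule distributed_distr_eq_density[OF d])
  finally show ?thesis unfolding char_def using f by (simp add: integral_density)
qed

text \<open>The integrand has norm \<open>f x\<close>, and \<open>f\<close> has total mass 1 as the
  density of a probability law. This justifies splitting the integral of a finite mixture.\<close>

lemma integrable_has_pdf_iexp:
  assumes "prob_space S" "has_pdf S Z f"
  shows "integrable lborel (\<lambda>x. f x *\<^sub>R iexp (u * x))"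
proof -
  interpret prob_space S by fact
  have d: "distributed S lborel Z (\<lambda>x. ennreal (f x))" and f: "\<And>x. 0 \<le> f x"
    using assms by (auto simp: has_pdf_def)
  have [measurable]: "f \<in> borel_measurable borel"
    using distributed_real_measurable[OF _ d] f by simp
  have "(\<integral>\<^sup>+ x. ennreal (f x) \<partial>lborel) = emeasure (density lborel f) UNIV"
    by (simp add: emeasure_density)
  also have "density lborel f = distr S lborel Z" by (rule distributed_distr_eq_density[OF d, symmetric])
  also have "emeasure \<dots> UNIV = 1"
    using prob_space.emeasure_space_1[OF prob_space_distr[OF distributed_measurable[OF d]]] by simp
  finally have "integrable lborel f" using f by (intro integrableI_nonneg) auto
  then show ?thesis by (rule Bochner_Integration.integrable_bound) (use f in auto)
qed

lemma char_shift:
  assumes [measurable]: "Z \<in> borel_measurable S"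
  shows "char (distr S borel (\<lambda>\<omega>. x + Z \<omega>)) u = iexp (u * x) * char (distr S borel Z) u"
  by (simp add: char_def integral_distr ring_distribs exp_add mult.assoc)

lemma char_const_AE:
  assumes "prob_space S" "Z \<in> borel_measurable S" "AE \<omega> in S. Z \<omega> = c"
  shows "char (distr S borel Z) u = iexp (u * c)"
proof -
  interpret prob_space S by fact
  have "distr S borel Z = distr S borel (\<lambda>_. c)" using assms by (intro distr_cong_AE) auto
  then show ?thesis by (simp add: char_def integral_distr prob_space del: distr_const)
qed

section \<open>Factorisation of the mixture of composite characteristic functions\<close>

theorem corollary3p3:
  fixes M :: nat and x0 lam :: real and F_eta :: "real \<Rightarrow> real"
    and S :: "'a measure" and W :: "nat \<Rightarrow> real \<Rightarrow> 'a \<Rightarrow> real" and P :: "nat \<Rightarrow> real \<Rightarrow> 'a \<Rightarrow> nat"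
    and eta :: "nat \<Rightarrow> nat \<Rightarrow> 'a \<Rightarrow> real"
    and b sig :: "nat \<Rightarrow> real \<Rightarrow> real \<Rightarrow> real"
    and Y :: "nat \<Rightarrow> real \<Rightarrow> real \<Rightarrow> 'a \<Rightarrow> real"
    and \<tau> :: "nat \<Rightarrow> ereal"
    and N :: "nat \<Rightarrow> nat" and \<theta> w :: "nat \<Rightarrow> nat \<Rightarrow> real"
    and f :: "(nat \<Rightarrow> real) \<Rightarrow> real \<Rightarrow> real \<Rightarrow> real"
    and S' :: "'b measure" and W' :: "real \<Rightarrow> 'b \<Rightarrow> real" and P' :: "real \<Rightarrow> 'b \<Rightarrow> nat"
    and eta' :: "nat \<Rightarrow> 'b \<Rightarrow> real" and X :: "real \<Rightarrow> 'b \<Rightarrow> real"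
    and u t :: real
  assumes lam: "0 \<le> lam"
    and noise: "driving_noise S {..M} lam F_eta W P eta"
    and coeff_bounded:
      "\<And>j s. j \<le> M \<Longrightarrow> 0 \<le> s \<Longrightarrow> bounded (range (b j s)) \<and> bounded (range (sig j s))"
    and component:
      "\<And>j z. j \<le> M \<Longrightarrow>
         component_process S (\<lambda>s. b j s z) (\<lambda>s. sig j s z) (W j) (P j) (eta j) (Y j z)"
    and switching: "\<tau> 0 = 0" "strict_mono_on {..Suc M} \<tau>" "\<tau> (Suc M) = \<infinity>"
    and weights: "\<And>j n. j \<le> M \<Longrightarrow> n \<in> {1..N j} \<Longrightarrow> 0 \<le> w j n"
      "\<And>j. j \<le> M \<Longrightarrow> (\<Sum>n = 1..N j. w j n) = 1"
    and composite_pdf: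
      "\<And>n s. n \<in> multi_indices M N \<Longrightarrow> 0 < s \<Longrightarrow>
         has_pdf S (composite_process M x0 \<tau> Y (multi_param M \<theta> n) s) (f (multi_param M \<theta> n) s)"
    and noise': "driving_noise S' {()} lam F_eta (\<lambda>_. W') (\<lambda>_. P') (\<lambda>_. eta')"
    and local_volatility_process:
      "unique_strong_solution S' W' P' eta'
         (local_drift M \<tau> b N w \<theta> f) (local_vol M \<tau> sig N w \<theta> f) x0 X"
    and local_volatility_pdf: "\<And>s. 0 < s \<Longrightarrow> has_pdf S' (X s) (mixture_density M N w \<theta> f s)"
    and t: "0 \<le> t"
  shows "char (distr S' borel (X t)) u =
    iexp (u * x0) *
    (\<Prod>j\<le>M. \<Sum>n = 1..N j.
       complex_of_real (w j n) * char (distr S borel (Y j (\<theta> j n) (stopped_clock \<tau> j t))) u)"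
proof -
  let ?I = "multi_indices M N" and ?s = "\<lambda>j. stopped_clock \<tau> j t"
  let ?c = "\<lambda>j n. char (distr S borel (Y j (\<theta> j n) (?s j))) u"
  interpret S: prob_space S using noise by (simp add: driving_noise_def)
  interpret S': prob_space S' using noise' by (simp add: driving_noise_def)
  have \<tau>_less: "\<tau> i < \<tau> j" if "i < j" "j \<le> Suc M" for i j
    using switching(2) that by (auto simp: strict_mono_on_def)
  have \<tau>_nonneg: "0 \<le> \<tau> j" if "j \<le> Suc M" for j
    using \<tau>_less[of 0 j] that switching(1) by (cases "j = 0") auto
  \<comment> \<open>\<open>real_of_ereal \<infinity> = 0\<close> could make the last branch of the
    clock negative, but that branch is unreachable when
    \<open>\<tau> (Suc j) = \<infinity>\<close>.\<close>
  have s_nonneg: "0 \<le> ?s j" if "j \<le> M" for j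
    using \<tau>_nonneg[of j] \<tau>_less[of j "Suc j"] that
    by (cases "\<tau> j"; cases "\<tau> (Suc j)") (auto simp: stopped_clock_def)
  have Y_meas: "Y j z r \<in> borel_measurable S" if "j \<le> M" "0 \<le> r" for j z r
    using component[of j z] that by (simp add: component_process_def)
  show ?thesis
  proof (cases "t = 0")
    case True
    have sol: "strong_solution S' W' P' eta'
         (local_drift M \<tau> b N w \<theta> f) (local_vol M \<tau> sig N w \<theta> f) x0 X"
      using local_volatility_process by (simp add: unique_strong_solution_def)
    have "W' r \<in> borel_measurable S'" "P' r \<in> measurable S' (count_space UNIV)" if "0 \<le> r" for r
      using noise' that by (auto simp: driving_noise_def brownian_motion_def poisson_process_def)
    moreover have "eta' i \<in> borel_measurable S'" if "1 \<le> i" for i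
      using noise' that by (auto simp: driving_noise_def)
    \<comment> \<open>Adaptedness puts \<open>X 0\<close> in the filtration at time 0, whose
      generators are all events of \<open>S'\<close>.\<close>
    ultimately have "X 0 \<in> borel_measurable S'"
      using sol unfolding strong_solution_def Let_def
      by (intro measurable_augmented_filtration[of "X 0" S' "{W', \<lambda>t \<omega>. real (P' t \<omega>), compound_sum P' eta'}" 0 S'])
        (auto intro!: compound_sum_measurable)
    moreover have "AE \<omega> in S'. X 0 \<omega> = x0" using sol by (simp add: strong_solution_def Let_def)
    ultimately have "char (distr S' borel (X t)) u = iexp (u * x0)"
      using True by (simp add: char_const_AE S'.prob_space_axioms)
    moreover have "?c j n = 1" if j: "j \<le> M" for j n
    proof -
      \<comment> \<open>Component 0 is active with elapsed time 0; every later one is still waiting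
        because \<open>0 < \<tau> j\<close>.\<close>
      have "?s j = 0"
        using True switching(1) \<tau>_less[of 0 j] \<tau>_less[of j "Suc j"] j
        by (cases "j = 0") (auto simp: stopped_clock_def zero_ereal_def)
      moreover have "AE \<omega> in S. P j 0 \<omega> = 0"
        using noise j by (auto simp: driving_noise_def poisson_process_def)
      then have "AE \<omega> in S. Y j (\<theta> j n) 0 \<omega> = 0"
        using component_process_0[OF _ component[OF j]] by (simp add: S.finite_measure_axioms)
      ultimately show ?thesis
        using char_const_AE[OF S.prob_space_axioms Y_meas[OF j order_refl], of "\<theta> j n" 0 u] by simp
    qed
    \<comment> \<open>With all component characteristic functions equal to 1, each factor is the sum
      of its weights, that is 1.\<close>
    ultimately show ?thesis
      using weights(2) by (simp flip: of_real_sum)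
  next
    case False
    then have t: "0 < t" using \<open>0 \<le> t\<close> by simp
    have comp: "char (distr S borel (composite_process M x0 \<tau> Y (multi_param M \<theta> n) t)) u
        = iexp (u * x0) * (\<Prod>j\<le>M. ?c j (n j))" for n
    proof -
      have "S.indep_vars (\<lambda>_. borel) (\<lambda>j. Y j (\<theta> j (n j)) (?s j)) {..M}"
        using indep_components[OF noise component] s_nonneg by auto
      note S.char_distr_sum[OF this, of u]
      \<comment> \<open>\<open>multi_param\<close> is cut off outside \<open>{..M}\<close>, but the
        sum evaluates it only there, so \<open>n\<close> may be arbitrary.\<close>
      moreover have "composite_process M x0 \<tau> Y (multi_param M \<theta> n) t
          = (\<lambda>\<omega>. x0 + (\<Sum>j\<le>M. Y j (\<theta> j (n j)) (?s j) \<omega>))"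
        by (auto simp: composite_process_def multi_param_def)
      ultimately show ?thesis
        using Y_meas s_nonneg by (simp add: char_shift borel_measurable_sum)
    qed
    have "char (distr S' borel (X t)) u
        = (CLINT x|lborel. mixture_density M N w \<theta> f t x *\<^sub>R iexp (u * x))"
      by (rule char_has_pdf[OF local_volatility_pdf[OF t]])
    also have "\<dots> = (CLINT x|lborel. \<Sum>n\<in>?I. multi_weight M w n *\<^sub>R (f (multi_param M \<theta> n) t x *\<^sub>R iexp (u * x)))"
      unfolding mixture_density_def by (simp add: scaleR_sum_left)
    also have "\<dots> = (\<Sum>n\<in>?I. multi_weight M w n *\<^sub>R
        (CLINT x|lborel. f (multi_param M \<theta> n) t x *\<^sub>R iexp (u * x)))"
      using integrable_has_pdf_iexp[OF S.prob_space_axioms composite_pdf[OF _ t]]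
      by (subst Bochner_Integration.integral_sum) (auto simp del: scaleR_scaleR)
    \<comment> \<open>The density formula, read backwards, turns each integral into the
      characteristic function of a composite process, which \<open>comp\<close> evaluates.\<close>
    also have "\<dots> = (\<Sum>n\<in>?I. multi_weight M w n *\<^sub>R (iexp (u * x0) * (\<Prod>j\<le>M. ?c j (n j))))"
      using char_has_pdf[OF composite_pdf[OF _ t], of _ u] comp by (intro sum.cong) auto
    also have "\<dots> = iexp (u * x0) * (\<Sum>n\<in>?I. \<Prod>j\<le>M. complex_of_real (w j (n j)) * ?c j (n j))"
      by (simp add: multi_weight_def prod.distrib sum_distrib_left scaleR_conv_of_real mult_ac)
    \<comment> \<open>Distributive law: a multi-index picks one summand from each of the
      \<open>M + 1\<close> factors.\<close>
    also have "(\<Sum>n\<in>?I. \<Prod>j\<le>M. complex_of_real (w j (n j)) * ?c j (n j))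
        = (\<Prod>j\<le>M. \<Sum>n = 1..N j. complex_of_real (w j n) * ?c j n)"
      unfolding multi_indices_def by (subst prod_sum_PiE) auto
    finally show ?thesis .
  qed
qed

end
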